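(* Let $\mathcal{X}\subseteq\mathbb{R}^n$ be closed and convex, let $H:\mathbb{R}^m\to\mathbb{R}$ be differentiable, strongly convex with parameter $\mu>0$, with $\nabla H$ Lipschitz continuous with constant $L>0$, let $R:\mathbb{R}^n\to\mathbb{R}$ be convex (possibly non-smooth), and let $\mathbf{B}=(B_1,\dots,B_m)^\top:\mathbb{R}^n\to\mathbb{R}^m$ be smooth with Jacobian $\mathbf{J_B}(x)\in\mathbb{R}^{m\times n}$ at $x$. Assume that $H\circ\mathbf{B}$ is convex over $\mathcal{X}$ and that: (A1) each $B_i$ is twice continuously differentiable, Lipschitz continuous on $\mathbb{R}^n$ with constant $\bar L_i\ge 0$, and has Lipschitz continuous gradient with constant $L_i\ge 0$, $i=1,\dots,m$; set $r:=\bar L_1^2+\cdots+\bar L_m^2$; (A2) there is $\tau>0$ such that $\tau\|x-y\|^2\le\|\mathbf{B}(x)-\mathbf{B}(y)\|^2$ for all $x,y\in\operatorname{span}(\mathcal{X})$; (A3) there is $\xi\ge 0$ such that for all $x,y\in\operatorname{span}(\mathcal{X})$, $$\left|\nabla H(\mathbf{B}(y))^\top\big(\mathbf{J_B}(x)-\mathbf{J_B}(y)\big)(x-y)\right|\le \xi\|x-y\|^2 .$$ Assume further that $\tau\mu-\xi>0$. Let $F(x):=H(\mathbf{B}(x))+R(x)$ and let $x^*$ be an optimal solution of $\min_{x\in\mathcal{X}}F(x)$. Let $(x^k)_{k\ge0},(y^k)_{k\ge0},(z^k)_{k\ge0}$ be the sequences generated by the algorithm C-FISTA (defined in the context) with the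 constants $r,L,\mu,\xi,\tau$ from an arbitrary starting point $(x^0,z^0)\in\mathcal{X}\times\mathcal{X}$. Then for every $k\ge 0$, $$F(x^{k+1})-F(x^* )+\frac{\tau\mu-\xi}{2}\|z^{k+1}-x^*\|^2\le\left(1-\frac{\sqrt{(\tau\mu-\xi)(rL-\xi)}}{rL}\right)\left(F(x^k)-F(x^* )+\frac{\tau\mu-\xi}{2}\|z^k-x^*\|^2\right).$$ In particular, for every $k\ge 0$, $$F(x^k)-F(x^* )\le\left(1-\frac{\sqrt{(\tau\mu-\xi)(rL-\xi)}}{rL}\right)^k\left(F(x^0)-F(x^* )+\frac{\tau\mu-\xi}{2}\|z^0-x^*\|^2\right).$$
   Context: Norms are Euclidean, and $\operatorname{span}(\mathcal{X})$ is the linear span of $\mathcal{X}$ in $\mathbb{R}^n$. $H$ is strongly convex with parameter $\mu$ if $H(v)\ge H(u)+\nabla H(u)^\top(v-u)+\frac{\mu}{2}\|v-u\|^2$ for all $u,v\in\mathbb{R}^m$. Algorithm C-FISTA. Set $$\theta:=\frac{\sqrt{(\tau\mu-\xi)(rL-\xi)}}{rL},\qquad \alpha:=\sqrt{\frac{rL-\xi}{\tau\mu-\xi}} .$$ Choose any $(x^0,z^0)\in\mathcal{X}\times\mathcal{X}$. For $k=0,1,2,\dots$ define $$y^k:=\frac{1}{1+\theta}x^k+\frac{\theta}{1+\theta}z^k,$$ $$x^{k+1}:=\arg\min_{x\in\mathcal{X}}\left\{H(\mathbf{B}(y^k))+\big(\mathbf{J_B}(y^k)^\top\nabla H(\mathbf{B}(y^k))\big)^\top(x-y^k)+\frac{rL}{2}\|x-y^k\|^2+R(x)\right\},$$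 $$z^{k+1}:=(1-\theta)z^k+\theta y^k+\alpha(x^{k+1}-y^k).$$ Here $\mathbf{J_B}(y)^\top\nabla H(\mathbf{B}(y))$ is the gradient of $H\circ\mathbf{B}$ at $y$. *)

theory Defs
  imports "HOL-Analysis.Analysis"
begin

text \<open>\<open>grad f x\<close> is unspecified unless \<open>f\<close> is differentiable at \<open>x\<close>.\<close>

definition grad :: "('a::real_inner \<Rightarrow> real) \<Rightarrow> 'a \<Rightarrow> 'a" where
  "grad f x = (THE D. gderiv f x D)"

text \<open>The Jacobian of the gradient is the Hessian.\<close>

definition twice_cont_diff :: "(real^'n \<Rightarrow> real) \<Rightarrow> bool" where
  "twice_cont_diff f \<longleftrightarrow>
     (\<forall>x. f differentiable (at x)) \<and>
     (\<forall>x. grad f differentiable (at x)) \<and>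
     continuous_on UNIV (\<lambda>x. jacobian (grad f) (at x))"

definition strongly_convex :: "real \<Rightarrow> ('a::real_inner \<Rightarrow> real) \<Rightarrow> bool" where
  "strongly_convex \<mu> H \<longleftrightarrow>
     (\<forall>u v. H v \<ge> H u + grad H u \<bullet> (v - u) + \<mu> / 2 * (norm (v - u))\<^sup>2)"

definition cf_theta :: "real \<Rightarrow> real \<Rightarrow> real \<Rightarrow> real \<Rightarrow> real \<Rightarrow> real" where
  "cf_theta r L \<mu> \<xi> \<tau> = sqrt ((\<tau> * \<mu> - \<xi>) * (r * L - \<xi>)) / (r * L)"

definition cf_alpha :: "real \<Rightarrow> real \<Rightarrow> real \<Rightarrow> real \<Rightarrow> real \<Rightarrow> real" where
  "cf_alpha r L \<mu> \<xi> \<tau> = sqrt ((r * L - \<xi>) / (\<tau> * \<mu> - \<xi>))"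

definition cf_objective ::
  "(real^'m \<Rightarrow> real) \<Rightarrow> (real^'n \<Rightarrow> real^'m) \<Rightarrow> (real^'n \<Rightarrow> real) \<Rightarrow> real \<Rightarrow> real
    \<Rightarrow> real^'n \<Rightarrow> real^'n \<Rightarrow> real" where
  "cf_objective H B R r L y x =
     H (B y) + (transpose (jacobian B (at y)) *v grad H (B y)) \<bullet> (x - y)
       + r * L / 2 * (norm (x - y))\<^sup>2 + R x"

text \<open>
  The update of \<open>x\<close> is stated relationally: \<open>x (Suc k)\<close> is a minimizer over \<open>X\<close>.  For \<open>R\<close> convex,
  \<open>X\<close> nonempty, closed and convex, and \<open>r * L > 0\<close>, the minimizer exists and is unique.
\<close>

definition c_fista ::
  "(real^'n) set \<Rightarrow> (real^'m \<Rightarrow> real) \<Rightarrow> (real^'n \<Rightarrow> real^'m) \<Rightarrow> (real^'n \<Rightarrow> real)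
    \<Rightarrow> real \<Rightarrow> real \<Rightarrow> real \<Rightarrow> real \<Rightarrow> real
    \<Rightarrow> (nat \<Rightarrow> real^'n) \<Rightarrow> (nat \<Rightarrow> real^'n) \<Rightarrow> (nat \<Rightarrow> real^'n) \<Rightarrow> bool" where
  "c_fista X H B R r L \<mu> \<xi> \<tau> x y z \<longleftrightarrow>
     (let \<theta> = cf_theta r L \<mu> \<xi> \<tau>; \<alpha> = cf_alpha r L \<mu> \<xi> \<tau> in
       x 0 \<in> X \<and> z 0 \<in> X \<and>
       (\<forall>k. y k = (1 / (1 + \<theta>)) *\<^sub>R x k + (\<theta> / (1 + \<theta>)) *\<^sub>R z k \<and>
            is_arg_min (cf_objective H B R r L (y k)) (\<lambda>w. w \<in> X) (x (Suc k)) \<and>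
            z (Suc k) = (1 - \<theta>) *\<^sub>R z k + \<theta> *\<^sub>R y k + \<alpha> *\<^sub>R (x (Suc k) - y k)))"

lemma grad_eqI:
  assumes "gderiv f x D"
  shows "grad f x = D"
proof -
  have "E = D" if "gderiv f x E" for E
  proof -
    have "(\<lambda>h. h \<bullet> E) = (\<lambda>h. h \<bullet> D)"
      using has_derivative_unique[OF that[unfolded gderiv_def] assms[unfolded gderiv_def]] .
    then have "(E - D) \<bullet> E = (E - D) \<bullet> D"
      by (rule fun_cong)
    then have "(E - D) \<bullet> (E - D) = 0"
      by (simp only: inner_diff_right)
    then show ?thesis
      by simp
  qed
  with assms show ?thesis
    unfolding grad_def by (rule the_equality)
qed

lemma gderiv_grad:
  fixes f :: "'a::euclidean_space \<Rightarrow> real"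
  assumes "f differentiable (at x)"
  shows "gderiv f x (grad f x)"
proof -
  obtain f' where f': "(f has_derivative f') (at x)"
    using assms unfolding differentiable_def by blast
  then have lin: "linear f'"
    by (rule has_derivative_linear)
  have "gderiv f x (adjoint f' 1)"
    using f' adjoint_works[OF lin, of _ 1] unfolding gderiv_def by simp
  then show ?thesis
    by (simp only: grad_eqI)
qed

lemma grad_comp_eq:
  fixes B :: "real^'n \<Rightarrow> real^'m" and H :: "real^'m \<Rightarrow> real"
  assumes "B differentiable (at y)" "H differentiable (at (B y))"
  shows "grad (H \<circ> B) y = transpose (jacobian B (at y)) *v grad H (B y)"
proof (rule grad_eqI)
  have 1: "(B has_derivative (\<lambda>h. jacobian B (at y) *v h)) (at y)"
    using assms(1) jacobian_works by blast
  have 2: "(H has_derivative (\<lambda>h. h \<bullet> grad H (B y))) (at (B y))"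
    using gderiv_grad[OF assms(2)] unfolding gderiv_def .
  show "gderiv (H \<circ> B) y (transpose (jacobian B (at y)) *v grad H (B y))"
    using diff_chain_at[OF 1 2]
    unfolding gderiv_def o_def by (simp add: dot_lmul_matrix[symmetric] inner_commute)
qed

end

theory Submission
  imports Defs
begin

text \<open>
  Write \<open>G = H \<circ> B\<close>, \<open>s = \<tau> * \<mu> - \<xi>\<close> and \<open>M = r * L\<close>.  Assumption (A3), integrated along
  a segment, says that replacing \<open>B\<close> by its linearization inside \<open>\<nabla>H (B y) \<bullet> B\<close> costs at most
  \<open>\<xi> / 2 * (norm (x - y))\<^sup>2\<close>.  Hence on \<open>span X\<close> the function \<open>G\<close> is bounded below and above by
  its tangent plus quadratics with constants \<open>s\<close> and \<open>M + \<xi>\<close>.  The step of C-FISTA only uses the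
  constant \<open>M\<close>, but the optimality condition of the subproblem supplies an extra
  \<open>M * (norm (x - y))\<^sup>2\<close>, so a decrease with constant \<open>M - (M + \<xi>) / 2 = (M - \<xi>) / 2\<close> survives.
  Weighting the resulting inequality at \<open>x k\<close> and \<open>xstar\<close> with \<open>1 - \<theta>\<close> and \<open>\<theta>\<close>, the choice of
  \<open>\<theta>\<close>, \<open>\<alpha>\<close> and \<open>y\<close> makes all cross terms cancel.
\<close>

section \<open>Quadratic bounds from derivatives along segments\<close>

text \<open>\<open>f\<close> minus its tangent at 0 minus \<open>c / 2 * t^2\<close> is
  nonincreasing on [0, 1]. The derivative is compared only with its value at 0, because (A3)
  compares Jacobians only with the one at the base point; leaving out t = 0 lets users divide by
  \<open>t\<close>.\<close>

lemma quadratic_upper_bound_real: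
  fixes f f' :: "real \<Rightarrow> real"
  assumes "\<And>t. (f has_real_derivative f' t) (at t)"
    and "\<And>t. 0 < t \<Longrightarrow> t \<le> 1 \<Longrightarrow> f' t - f' 0 \<le> c * t"
  shows "f 1 - f 0 - f' 0 \<le> c / 2"
proof -
  define g where "g t = f t - t * f' 0 - c / 2 * t\<^sup>2" for t
  have "g 1 \<le> g 0"
  proof (rule DERIV_nonpos_imp_nonincreasing[of 0 1 g])
    fix t :: real
    assume t: "0 \<le> t" "t \<le> 1"
    have "(g has_real_derivative f' t - f' 0 - c * t) (at t)"
      unfolding g_def by (auto intro!: derivative_eq_intros assms(1))
    moreover have "f' t - f' 0 - c * t \<le> 0"
      using assms(2)[of t] t by (cases "t = 0") auto
    ultimately show "\<exists>y. (g has_real_derivative y) (at t) \<and> y \<le> 0"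
      by blast
  qed simp
  then show ?thesis
    by (simp add: g_def)
qed

lemma has_derivative_along_line:
  fixes f :: "'a::real_normed_vector \<Rightarrow> real"
  assumes "(f has_derivative f') (at (y + t *\<^sub>R d))"
  shows "((\<lambda>t. f (y + t *\<^sub>R d)) has_real_derivative f' d) (at t)"
proof -
  have 1: "((\<lambda>t. y + t *\<^sub>R d) has_derivative (\<lambda>h. h *\<^sub>R d)) (at t)"
    by (auto intro!: derivative_eq_intros)
  have "(f \<circ> (\<lambda>t. y + t *\<^sub>R d) has_derivative f' \<circ> (\<lambda>h. h *\<^sub>R d)) (at t)"
    by (rule diff_chain_at[OF 1 assms])
  moreover have "f' \<circ> (\<lambda>h. h *\<^sub>R d) = (*) (f' d)"
    using linear_cmul[OF has_derivative_linear[OF assms]] by (auto simp: mult.commute)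
  ultimately show ?thesis
    by (simp add: has_field_derivative_def o_def)
qed

lemma quadratic_upper_bound:
  fixes f :: "'a::real_normed_vector \<Rightarrow> real"
  assumes "\<And>u. (f has_derivative f' u) (at u)"
    and "\<And>t. 0 < t \<Longrightarrow> t \<le> 1 \<Longrightarrow> f' (y + t *\<^sub>R (x - y)) (x - y) - f' y (x - y) \<le> c * t"
  shows "f x - f y - f' y (x - y) \<le> c / 2"
  using quadratic_upper_bound_real
      [of "\<lambda>t. f (y + t *\<^sub>R (x - y))" "\<lambda>t. f' (y + t *\<^sub>R (x - y)) (x - y)" c]
    has_derivative_along_line[OF assms(1)] assms(2)
  by simp

lemma lipschitz_gradient_upper_bound:
  fixes H :: "'a::euclidean_space \<Rightarrow> real"
  assumes "\<And>u. H differentiable (at u)" and "L-lipschitz_on UNIV (grad H)"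
  shows "H v \<le> H u + grad H u \<bullet> (v - u) + L / 2 * (norm (v - u))\<^sup>2"
proof -
  have "H v - H u - (v - u) \<bullet> grad H u \<le> L * (norm (v - u))\<^sup>2 / 2"
  proof (rule quadratic_upper_bound)
    show "(H has_derivative (\<lambda>h. h \<bullet> grad H w)) (at w)" for w
      using gderiv_grad[OF assms(1)] unfolding gderiv_def .
  next
    fix t :: real
    assume t: "0 < t" "t \<le> 1"
    let ?w = "u + t *\<^sub>R (v - u)"
    have "(v - u) \<bullet> grad H ?w - (v - u) \<bullet> grad H u \<le> norm (v - u) * norm (grad H ?w - grad H u)"
      by (metis inner_diff_right norm_cauchy_schwarz)
    also have "\<dots> \<le> norm (v - u) * (L * norm (?w - u))"
      using lipschitz_onD[OF assms(2), of ?w u]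
      by (intro mult_left_mono) (auto simp: dist_norm)
    also have "\<dots> = L * (norm (v - u))\<^sup>2 * t"
      using t by (simp add: power2_eq_square)
    finally show "(v - u) \<bullet> grad H ?w - (v - u) \<bullet> grad H u \<le> L * (norm (v - u))\<^sup>2 * t" .
  qed
  then show ?thesis
    by (simp add: inner_commute)
qed

lemma differentiable_componentwise_vec:
  fixes B :: "real^'n \<Rightarrow> real^'m"
  assumes "\<And>i. (\<lambda>x. B x $ i) differentiable (at u)"
  shows "B differentiable (at u)"
proof -
  have "(\<lambda>x. B x \<bullet> b) differentiable (at u)" if "b \<in> Basis" for b
    using that assms by (auto simp: Basis_vec_def inner_axis)
  then show ?thesis
    using differentiable_componentwise_within by blast
qed

text \<open>Squaring and adding the coordinate bounds is what makes \<open>r\<close> a sum of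
  squares.\<close>

lemma lipschitz_componentwise_vec:
  fixes B :: "'a::real_normed_vector \<Rightarrow> real^'m"
  assumes "\<And>i. (K i)-lipschitz_on UNIV (\<lambda>x. B x $ i)"
  shows "(norm (B x - B y))\<^sup>2 \<le> (\<Sum>i\<in>UNIV. (K i)\<^sup>2) * (norm (x - y))\<^sup>2"
proof -
  have "(norm (B x - B y))\<^sup>2 = (\<Sum>i\<in>UNIV. \<bar>B x $ i - B y $ i\<bar>\<^sup>2)"
    unfolding power2_norm_eq_inner inner_vec_def by (simp add: power2_eq_square)
  also have "\<dots> \<le> (\<Sum>i\<in>UNIV. (K i * norm (x - y))\<^sup>2)"
    using lipschitz_onD[OF assms, of x y]
    by (intro sum_mono power_mono) (auto simp: dist_norm)
  finally show ?thesis
    by (simp add: power_mult_distrib sum_distrib_right)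
qed

text \<open>With \<open>g\<close> frozen, the scalar function \<open>g \<bullet> B u\<close> is
  treated by \<open>quadratic_upper_bound\<close>. The set \<open>S\<close> is a subspace so that
  the whole segment from \<open>y\<close> to \<open>x\<close> lies in it.\<close>

lemma linearization_error:
  fixes B :: "real^'n \<Rightarrow> real^'m"
  assumes diff: "\<And>u. B differentiable (at u)" and S: "subspace S" "x \<in> S" "y \<in> S"
    and A3: "\<And>w. w \<in> S \<Longrightarrow> \<bar>g \<bullet> ((jacobian B (at w) - jacobian B (at y)) *v (w - y))\<bar>
               \<le> \<xi> * (norm (w - y))\<^sup>2"
  shows "\<bar>g \<bullet> (B x - B y) - g \<bullet> (jacobian B (at y) *v (x - y))\<bar> \<le> \<xi> / 2 * (norm (x - y))\<^sup>2"
proof -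
  let ?J = "\<lambda>u. jacobian B (at u)"
  \<comment> \<open>Taking \<open>h\<close> to be \<open>g\<close> and \<open>- g\<close> yields
    both halves of the absolute value from a one-sided bound.\<close>
  have bound: "h \<bullet> (B x - B y) - h \<bullet> (?J y *v (x - y)) \<le> \<xi> * (norm (x - y))\<^sup>2 / 2"
    if h: "h = g \<or> h = - g" for h
  proof -
    have "h \<bullet> B x - h \<bullet> B y - h \<bullet> (?J y *v (x - y)) \<le> \<xi> * (norm (x - y))\<^sup>2 / 2"
    proof (rule quadratic_upper_bound)
      fix u
      have "(B has_derivative (\<lambda>v. ?J u *v v)) (at u)"
        using diff jacobian_works by blast
      then show "((\<lambda>u. h \<bullet> B u) has_derivative (\<lambda>v. h \<bullet> (?J u *v v))) (at u)"
        by (rule has_derivative_inner_right)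
    next
      fix t :: real
      assume t: "0 < t" "t \<le> 1"
      define w where "w = y + t *\<^sub>R (x - y)"
      have "w \<in> S"
        unfolding w_def using S by (intro subspace_add subspace_scale subspace_diff)
      from A3[OF this]
      have "h \<bullet> ((?J w - ?J y) *v (w - y)) \<le> \<xi> * (norm (w - y))\<^sup>2"
        using h by auto
      \<comment> \<open>Since \<open>w - y\<close> is \<open>t\<close> times \<open>x - y\<close>,
        (A3) carries one factor \<open>t\<close> on the left and two on the right; cancelling one
        leaves the required linear bound.\<close>
      then have "t * (h \<bullet> ((?J w - ?J y) *v (x - y))) \<le> t * (\<xi> * (norm (x - y))\<^sup>2 * t)"
        by (simp add: w_def matrix_vector_mult_scaleR power_mult_distrib power2_eq_square mult_ac)
      then have "h \<bullet> ((?J w - ?J y) *v (x - y)) \<le> \<xi> * (norm (x - y))\<^sup>2 * t"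
        using t by (simp add: mult_le_cancel_left)
      then show "h \<bullet> (?J (y + t *\<^sub>R (x - y)) *v (x - y)) - h \<bullet> (?J y *v (x - y))
          \<le> \<xi> * (norm (x - y))\<^sup>2 * t"
        by (simp add: w_def matrix_vector_mult_diff_rdistrib inner_diff_right)
    qed
    then show ?thesis
      by (simp add: inner_diff_right)
  qed
  from bound[of g] bound[of "- g"] show ?thesis
    by (simp only: abs_le_iff inner_minus_left) simp
qed

section \<open>The proximal subproblem\<close>

text \<open>Compare the minimizer \<open>p\<close> with \<open>p + t (u - p)\<close>, divide by
  \<open>t\<close> and let \<open>t\<close> tend to 0 from the right. Since \<open>R\<close> may be
  non-smooth, convexity replaces its directional derivative by \<open>R u - R p\<close>.\<close>

lemma proximal_step_variational_inequality:
  fixes c y :: "'a::real_inner"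
  assumes "convex X" "convex_on X R"
    and min: "is_arg_min (\<lambda>w. a + c \<bullet> (w - y) + M / 2 * (norm (w - y))\<^sup>2 + R w) (\<lambda>w. w \<in> X) p"
    and u: "u \<in> X"
  shows "0 \<le> (c + M *\<^sub>R (p - y)) \<bullet> (u - p) + R u - R p"
proof -
  let ?V = "(c + M *\<^sub>R (p - y)) \<bullet> (u - p) + R u - R p"
  have p: "p \<in> X"
    using min by (simp add: is_arg_min_def)
  have ineq: "0 \<le> ?V + t * (M / 2 * (norm (u - p))\<^sup>2)" if t: "0 < t" "t < 1" for t
  proof -
    let ?w = "p + t *\<^sub>R (u - p)"
    have w: "?w = (1 - t) *\<^sub>R p + t *\<^sub>R u"
      by (simp add: algebra_simps)
    have "?w \<in> X"
      unfolding w using \<open>convex X\<close> p u t by (intro convexD) auto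
    with min have 1: "c \<bullet> (p - y) + M / 2 * (norm (p - y))\<^sup>2 + R p
        \<le> c \<bullet> (?w - y) + M / 2 * (norm (?w - y))\<^sup>2 + R ?w"
      by (auto simp: is_arg_min_linorder)
    have 2: "R ?w \<le> (1 - t) * R p + t * R u"
      unfolding w using convex_onD[OF assms(2), of t p u] p u t by simp
    have 3: "(norm (?w - y))\<^sup>2
        = (norm (p - y))\<^sup>2 + 2 * t * ((p - y) \<bullet> (u - p)) + t\<^sup>2 * (norm (u - p))\<^sup>2"
    proof -
      have w': "?w - y = (p - y) + t *\<^sub>R (u - p)"
        by simp
      show ?thesis
        unfolding w' power2_norm_eq_inner inner_add_left inner_add_right
        by (simp add: inner_commute power2_eq_square)
    qed
    have 4: "c \<bullet> (?w - y) = c \<bullet> (p - y) + t * (c \<bullet> (u - p))"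
      by (simp add: inner_diff_right inner_add_right)
    have "t * ?V + t * (t * (M / 2 * (norm (u - p))\<^sup>2)) \<ge> 0"
      using 1 2 unfolding 3 4
      by (simp add: inner_add_left power2_eq_square algebra_simps)
    then have "t * (?V + t * (M / 2 * (norm (u - p))\<^sup>2)) \<ge> 0"
      by (simp only: distrib_left)
    then show ?thesis
      using t by (simp add: zero_le_mult_iff)
  qed
  have "((\<lambda>t. ?V + t * (M / 2 * (norm (u - p))\<^sup>2)) \<longlongrightarrow> ?V + 0 * (M / 2 * (norm (u - p))\<^sup>2))
      (at_right 0)"
    by (intro tendsto_intros)
  moreover have "\<forall>\<^sub>F t in at_right 0. 0 \<le> ?V + t * (M / 2 * (norm (u - p))\<^sup>2)"
    using ineq by (auto simp only: eventually_at_right_field intro!: exI[of _ 1])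
  ultimately show ?thesis
    using tendsto_lowerbound by fastforce
qed

text \<open>The variational inequality, expanded around \<open>y\<close>, trades the linear term at
  \<open>p\<close> for the one at \<open>u\<close>; \<open>upper\<close> and \<open>lower\<close>
  then turn these into \<open>G p\<close> and \<open>G u\<close>.\<close>

lemma proximal_step_decrease:
  fixes c y :: "'a::real_inner"
  assumes "convex X" "convex_on X R"
    and min: "is_arg_min (\<lambda>w. a + c \<bullet> (w - y) + M / 2 * (norm (w - y))\<^sup>2 + R w) (\<lambda>w. w \<in> X) p"
    and u: "u \<in> X"
    and lower: "a + c \<bullet> (u - y) + s / 2 * (norm (u - y))\<^sup>2 \<le> G u"
    and upper: "G p \<le> a + c \<bullet> (p - y) + (M + \<xi>) / 2 * (norm (p - y))\<^sup>2"
  shows "G p + R p \<le> G u + R u - M * ((y - p) \<bullet> (u - y)) - s / 2 * (norm (u - y))\<^sup>2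
           - (M - \<xi>) / 2 * (norm (y - p))\<^sup>2"
proof -
  have V: "0 \<le> (c + M *\<^sub>R (p - y)) \<bullet> (u - p) + R u - R p"
    by (rule proximal_step_variational_inequality[OF assms(1,2) min u])
  have "(c + M *\<^sub>R (p - y)) \<bullet> (u - p)
      = c \<bullet> (u - y) - c \<bullet> (p - y) - M * ((y - p) \<bullet> (u - y)) - M * (norm (y - p))\<^sup>2"
    by (simp add: power2_norm_eq_inner inner_add inner_diff inner_commute algebra_simps)
  with V lower upper show ?thesis
    by (simp add: norm_minus_commute[of p y] field_simps)
qed

section \<open>Contraction of the Lyapunov function\<close>

text \<open>Expanding the square of \<open>z' - q\<close> produces inner products with factor
  \<open>s * \<alpha>\<close> and a square with factor \<open>s * \<alpha>^2\<close>. The two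
  conditions on \<open>\<alpha>\<close> match these to the terms with \<open>M\<close> and
  \<open>D\<close> in the decrease inequalities.\<close>

lemma estimate_sequence_contraction:
  fixes x y z p q :: "'a::real_inner"
  assumes \<theta>: "0 \<le> \<theta>" "\<theta> \<le> 1" and s: "0 \<le> s"
    and \<alpha>: "s * \<alpha> = \<theta> * M" "s * \<alpha>\<^sup>2 = D"
    and y: "y = (1 / (1 + \<theta>)) *\<^sub>R x + (\<theta> / (1 + \<theta>)) *\<^sub>R z"
    and z': "z' = (1 - \<theta>) *\<^sub>R z + \<theta> *\<^sub>R y + \<alpha> *\<^sub>R (p - y)"
    and decr_x: "Fp \<le> Fx - M * ((y - p) \<bullet> (x - y)) - D / 2 * (norm (y - p))\<^sup>2"
    and decr_q: "Fp \<le> Fq - M * ((y - p) \<bullet> (q - y)) - s / 2 * (norm (q - y))\<^sup>2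
                   - D / 2 * (norm (y - p))\<^sup>2"
  shows "Fp - Fq + s / 2 * (norm (z' - q))\<^sup>2
           \<le> (1 - \<theta>) * (Fx - Fq + s / 2 * (norm (z - q))\<^sup>2)"
proof -
  \<comment> \<open>By the choice of \<open>y\<close>, all differences that occur are combinations
    of these three vectors.\<close>
  define a b e where "a = z - q" and "b = y - q" and "e = y - p"
  have "(1 + \<theta>) *\<^sub>R y = x + \<theta> *\<^sub>R z"
    unfolding y using \<theta> by (simp add: scaleR_add_right)
  then have xy: "x - y = \<theta> *\<^sub>R (b - a)"
    by (simp add: a_def b_def algebra_simps)
  have qy: "q - y = - b"
    by (simp add: b_def)
  have zq: "z' - q = ((1 - \<theta>) *\<^sub>R a + \<theta> *\<^sub>R b) - \<alpha> *\<^sub>R e"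
    by (simp add: z' a_def b_def e_def algebra_simps)
  let ?c = "(1 - \<theta>) *\<^sub>R a + \<theta> *\<^sub>R b"
  have 1: "Fp \<le> Fx - M * \<theta> * (e \<bullet> b - e \<bullet> a) - D / 2 * (norm e)\<^sup>2"
    using decr_x unfolding xy e_def[symmetric] by (simp add: inner_diff_right)
  have 2: "Fp \<le> Fq + M * (e \<bullet> b) - s / 2 * (norm b)\<^sup>2 - D / 2 * (norm e)\<^sup>2"
    using decr_q unfolding qy e_def[symmetric] by simp
  have F: "Fp \<le> (1 - \<theta>) * (Fx - M * \<theta> * (e \<bullet> b - e \<bullet> a) - D / 2 * (norm e)\<^sup>2)
      + \<theta> * (Fq + M * (e \<bullet> b) - s / 2 * (norm b)\<^sup>2 - D / 2 * (norm e)\<^sup>2)"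
    using mult_left_mono[OF 1, of "1 - \<theta>"] mult_left_mono[OF 2 \<theta>(1)] \<theta>
    by (simp add: left_diff_distrib)
  \<comment> \<open>Exact form of the convexity of the squared norm; only the nonpositive last term
    is discarded.\<close>
  have "(norm ?c)\<^sup>2 = (1 - \<theta>) * (norm a)\<^sup>2 + \<theta> * (norm b)\<^sup>2 - \<theta> * (1 - \<theta>) * (norm (a - b))\<^sup>2"
    unfolding power2_norm_eq_inner
    by (simp add: inner_add inner_diff inner_commute power2_eq_square algebra_simps)
  also have "\<dots> \<le> (1 - \<theta>) * (norm a)\<^sup>2 + \<theta> * (norm b)\<^sup>2"
    using \<theta> by simp
  finally have c: "s / 2 * (norm ?c)\<^sup>2 \<le> s / 2 * ((1 - \<theta>) * (norm a)\<^sup>2 + \<theta> * (norm b)\<^sup>2)"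
    using s by (intro mult_left_mono) auto
  have "s / 2 * (norm (z' - q))\<^sup>2
      = s / 2 * (norm ?c)\<^sup>2 - (s * \<alpha>) * (e \<bullet> ?c) + (s * \<alpha>\<^sup>2) / 2 * (norm e)\<^sup>2"
    unfolding zq power2_norm_eq_inner
    by (simp only: inner_diff inner_scaleR_left inner_scaleR_right inner_commute[of ?c e])
       (simp add: power2_eq_square algebra_simps)
  also have "\<dots> = s / 2 * (norm ?c)\<^sup>2 - \<theta> * M * ((1 - \<theta>) * (e \<bullet> a) + \<theta> * (e \<bullet> b))
      + D / 2 * (norm e)\<^sup>2"
    unfolding \<alpha> by (simp add: inner_add_right)
  finally have E: "s / 2 * (norm (z' - q))\<^sup>2 = s / 2 * (norm ?c)\<^sup>2
      - \<theta> * M * ((1 - \<theta>) * (e \<bullet> a) + \<theta> * (e \<bullet> b)) + D / 2 * (norm e)\<^sup>2" .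
  have "Fp - Fq + s / 2 * (norm (z' - q))\<^sup>2
      \<le> (1 - \<theta>) * (Fx - M * \<theta> * (e \<bullet> b - e \<bullet> a) - D / 2 * (norm e)\<^sup>2)
        + \<theta> * (Fq + M * (e \<bullet> b) - s / 2 * (norm b)\<^sup>2 - D / 2 * (norm e)\<^sup>2) - Fq
        + s / 2 * ((1 - \<theta>) * (norm a)\<^sup>2 + \<theta> * (norm b)\<^sup>2)
        - \<theta> * M * ((1 - \<theta>) * (e \<bullet> a) + \<theta> * (e \<bullet> b)) + D / 2 * (norm e)\<^sup>2"
    using F c E by linarith
  \<comment> \<open>The coefficients of \<open>e \<bullet> a\<close>, \<open>e \<bullet> b\<close>,
    \<open>norm e\<close> squared and \<open>norm b\<close> squared all sum to zero.\<close>
  also have "\<dots> = (1 - \<theta>) * (Fx - Fq + s / 2 * (norm a)\<^sup>2)"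
    by (simp add: field_simps)
  finally show ?thesis
    unfolding a_def .
qed

section \<open>Application to C-FISTA\<close>

theorem theorem1:
  fixes X :: "(real^'n) set"
    and H :: "real^'m \<Rightarrow> real"
    and R :: "real^'n \<Rightarrow> real"
    and B :: "real^'n \<Rightarrow> real^'m"
    and \<mu> L r \<tau> \<xi> :: real
    and Lbar Lgrad :: "'m \<Rightarrow> real"
    and F :: "real^'n \<Rightarrow> real"
    and xstar :: "real^'n"
    and x y z :: "nat \<Rightarrow> real^'n"
  assumes "closed X" "convex X"
    and "\<forall>u. H differentiable (at u)"
    and "\<mu> > 0" "strongly_convex \<mu> H"
    and "L > 0" "L-lipschitz_on UNIV (grad H)"
    and "convex_on UNIV R"
    and "convex_on X (H \<circ> B)"
    and "\<forall>i. twice_cont_diff (\<lambda>x. B x $ i)"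
    and "\<forall>i. (Lbar i)-lipschitz_on UNIV (\<lambda>x. B x $ i)"
    and "\<forall>i. (Lgrad i)-lipschitz_on UNIV (grad (\<lambda>x. B x $ i))"
    and "r = (\<Sum>i\<in>UNIV. (Lbar i)\<^sup>2)"
    and "\<tau> > 0"
    and "\<forall>x\<in>span X. \<forall>y\<in>span X. \<tau> * (norm (x - y))\<^sup>2 \<le> (norm (B x - B y))\<^sup>2"
    and "\<xi> \<ge> 0"
    and "\<forall>x\<in>span X. \<forall>y\<in>span X.
           \<bar>grad H (B y) \<bullet> ((jacobian B (at x) - jacobian B (at y)) *v (x - y))\<bar>
             \<le> \<xi> * (norm (x - y))\<^sup>2"
    and "\<tau> * \<mu> - \<xi> > 0"
    and "F = (\<lambda>x. H (B x) + R x)"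
    and "is_arg_min F (\<lambda>x. x \<in> X) xstar"
    and "c_fista X H B R r L \<mu> \<xi> \<tau> x y z"
  shows "(\<forall>k. F (x (Suc k)) - F xstar + (\<tau> * \<mu> - \<xi>) / 2 * (norm (z (Suc k) - xstar))\<^sup>2
            \<le> (1 - sqrt ((\<tau> * \<mu> - \<xi>) * (r * L - \<xi>)) / (r * L))
                * (F (x k) - F xstar + (\<tau> * \<mu> - \<xi>) / 2 * (norm (z k - xstar))\<^sup>2))
       \<and> (\<forall>k. F (x k) - F xstar
            \<le> (1 - sqrt ((\<tau> * \<mu> - \<xi>) * (r * L - \<xi>)) / (r * L)) ^ k
                * (F (x 0) - F xstar + (\<tau> * \<mu> - \<xi>) / 2 * (norm (z 0 - xstar))\<^sup>2))"
proof -
  let ?\<theta> = "cf_theta r L \<mu> \<xi> \<tau>"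
  let ?\<alpha> = "cf_alpha r L \<mu> \<xi> \<tau>"
  define s M where "s = \<tau> * \<mu> - \<xi>" and "M = r * L"
  define V where "V k = F (x k) - F xstar + s / 2 * (norm (z k - xstar))\<^sup>2" for k
  \<comment> \<open>By the chain rule, \<open>c u\<close> is the gradient of
    \<open>H \<circ> B\<close> at \<open>u\<close>.\<close>
  define c where "c u = transpose (jacobian B (at u)) *v grad H (B u)" for u

  have s: "s > 0"
    using assms(18) by (simp add: s_def)
  have alg: "x 0 \<in> X" "z 0 \<in> X"
      "y k = (1 / (1 + ?\<theta>)) *\<^sub>R x k + (?\<theta> / (1 + ?\<theta>)) *\<^sub>R z k"
      "is_arg_min (cf_objective H B R r L (y k)) (\<lambda>w. w \<in> X) (x (Suc k))"
      "z (Suc k) = (1 - ?\<theta>) *\<^sub>R z k + ?\<theta> *\<^sub>R y k + ?\<alpha> *\<^sub>R (x (Suc k) - y k)" for k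
    using assms(21) unfolding c_fista_def Let_def by blast+
  have xX: "x k \<in> X" for k
    using alg(1) alg(4)[of "k - 1"] by (cases k) (auto simp: is_arg_min_def)
  then have xS: "x k \<in> span X" for k
    by (simp add: span_base)
  have qX: "xstar \<in> X"
    using assms(20) by (simp add: is_arg_min_def)
  \<comment> \<open>The extrapolated points \<open>z k\<close> need not stay in \<open>X\<close>, so
    they, and hence the \<open>y k\<close>, are tracked only in the span.\<close>
  have zS: "z k \<in> span X" for k
  proof (induction k)
    case 0
    then show ?case by (simp add: alg span_base)
  next
    case (Suc k)
    then show ?case
      unfolding alg(5) alg(3)[of k] by (intro span_add span_scale span_diff xS)
  qed
  have yS: "y k \<in> span X" for k
    unfolding alg(3) by (intro span_add span_scale xS zS)

  have diffB: "B differentiable (at u)" for u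
    using assms(10) by (intro differentiable_componentwise_vec) (auto simp: twice_cont_diff_def)
  have lipB: "(norm (B u - B v))\<^sup>2 \<le> r * (norm (u - v))\<^sup>2" for u v
    unfolding assms(13) using assms(11) by (intro lipschitz_componentwise_vec) auto
  have upperH: "H v \<le> H u + grad H u \<bullet> (v - u) + L / 2 * (norm (v - u))\<^sup>2" for u v
    using assms(3,7) by (intro lipschitz_gradient_upper_bound) auto
  have lowerH: "H u + grad H u \<bullet> (v - u) + \<mu> / 2 * (norm (v - u))\<^sup>2 \<le> H v" for u v
    using assms(5) by (auto simp: strongly_convex_def)
  have lin: "\<bar>grad H (B v) \<bullet> (B u - B v) - c v \<bullet> (u - v)\<bar> \<le> \<xi> / 2 * (norm (u - v))\<^sup>2"
    if "u \<in> span X" "v \<in> span X" for u v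
    using linearization_error[OF diffB subspace_span that, of "grad H (B v)" \<xi>] assms(17) that
    by (simp add: c_def dot_lmul_matrix[symmetric])
  \<comment> \<open>Strong convexity of \<open>H\<close> between \<open>B v\<close> and
    \<open>B u\<close> combined with (A2) gives the constant \<open>\<tau> * \<mu>\<close>;
    linearizing \<open>B\<close> costs \<open>\<xi>\<close>.\<close>
  have lower: "H (B v) + c v \<bullet> (u - v) + s / 2 * (norm (u - v))\<^sup>2 \<le> H (B u)"
    if "u \<in> span X" "v \<in> span X" for u v
  proof -
    have "\<mu> / 2 * (\<tau> * (norm (u - v))\<^sup>2) \<le> \<mu> / 2 * (norm (B u - B v))\<^sup>2"
      using assms(4,15) that by (intro mult_left_mono) auto
    moreover have "s / 2 * (norm (u - v))\<^sup>2
        = \<mu> / 2 * (\<tau> * (norm (u - v))\<^sup>2) - \<xi> / 2 * (norm (u - v))\<^sup>2"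
      by (simp add: s_def field_simps)
    ultimately show ?thesis
      using lowerH[of "B v" "B u"] lin[OF that] by linarith
  qed
  have upper: "H (B u) \<le> H (B v) + c v \<bullet> (u - v) + (M + \<xi>) / 2 * (norm (u - v))\<^sup>2"
    if "u \<in> span X" "v \<in> span X" for u v
  proof -
    have "L / 2 * (norm (B u - B v))\<^sup>2 \<le> L / 2 * (r * (norm (u - v))\<^sup>2)"
      using assms(6) lipB by (intro mult_left_mono) auto
    moreover have "(M + \<xi>) / 2 * (norm (u - v))\<^sup>2
        = L / 2 * (r * (norm (u - v))\<^sup>2) + \<xi> / 2 * (norm (u - v))\<^sup>2"
      by (simp add: M_def field_simps)
    ultimately show ?thesis
      using upperH[of "B u" "B v"] lin[OF that] by linarith
  qed

  have "V (Suc k) \<le> (1 - ?\<theta>) * V k \<and> V k \<le> (1 - ?\<theta>) ^ k * V 0" for k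
  proof (cases "X \<subseteq> {0}")
    case True
    \<comment> \<open>(A2) is then vacuous, so \<open>\<tau> \<le> r\<close> and \<open>\<theta> \<le> 1\<close> may fail and \<open>r\<close> may vanish.\<close>
    then have "span X = {0}"
      using qX by (auto simp: subset_singleton_iff)
    then have "V k = 0" for k
      using True xS[of k] zS[of k] qX by (auto simp: V_def)
    then show ?thesis
      by simp
  next
    case False
    \<comment> \<open>A nonzero \<open>u\<close> allows the constants to be compared: (A2) separates
      \<open>B u\<close> from \<open>B 0\<close>, so the two quadratic bounds on \<open>H\<close>
      give \<open>\<mu> \<le> L\<close>, and (A2) against the Lipschitz bound gives
      \<open>\<tau> \<le> r\<close>.\<close>
    then obtain u where u: "u \<in> span X" "u \<noteq> 0"
      by (auto intro: span_base)
    have \<tau>: "\<tau> * (norm u)\<^sup>2 \<le> (norm (B u - B 0))\<^sup>2"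
      using assms(15) u(1) span_zero[of X] by fastforce
    have "0 < \<tau> * (norm u)\<^sup>2"
      using assms(14) u(2) by simp
    with \<tau> have "0 < (norm (B u - B 0))\<^sup>2"
      by linarith
    moreover have "\<mu> / 2 * (norm (B u - B 0))\<^sup>2 \<le> L / 2 * (norm (B u - B 0))\<^sup>2"
      using lowerH[of "B 0" "B u"] upperH[of "B u" "B 0"] by simp
    ultimately have "\<mu> \<le> L"
      by (simp add: mult_le_cancel_right)
    have "\<tau> * (norm u)\<^sup>2 \<le> r * (norm u)\<^sup>2"
      using \<tau> lipB[of u 0] by simp
    then have "\<tau> \<le> r"
      using u(2) by (simp add: mult_le_cancel_right)
    with \<open>\<mu> \<le> L\<close> have "\<tau> * \<mu> \<le> M"
      unfolding M_def using assms(4,14) by (intro mult_mono) auto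
    then have M: "0 < M - \<xi>" "s \<le> M" "M - \<xi> \<le> M" "0 < M"
      using s assms(16) by (auto simp: s_def)
    have \<theta>_eq: "?\<theta> = sqrt (s * (M - \<xi>)) / M" and \<alpha>_eq: "?\<alpha> = sqrt ((M - \<xi>) / s)"
      by (simp_all add: cf_theta_def cf_alpha_def s_def M_def)
    have "sqrt (s * (M - \<xi>)) \<le> sqrt (M * M)"
      using M s by (intro real_sqrt_le_mono mult_mono) auto
    then have \<theta>: "0 \<le> ?\<theta>" "?\<theta> \<le> 1"
      using M s by (auto simp: \<theta>_eq)
    \<comment> \<open>As \<open>s / sqrt s = sqrt s\<close>, both \<open>s * ?\<alpha>\<close> and
      \<open>?\<theta> * M\<close> equal \<open>sqrt (s * (M - \<xi>))\<close>.\<close>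
    have "s * ?\<alpha> = s / sqrt s * sqrt (M - \<xi>)"
      by (simp add: \<alpha>_eq real_sqrt_divide)
    then have \<alpha>1: "s * ?\<alpha> = ?\<theta> * M"
      using M s by (simp only: real_div_sqrt) (simp add: \<theta>_eq real_sqrt_mult)
    have \<alpha>2: "s * ?\<alpha>\<^sup>2 = M - \<xi>"
      using M s by (simp add: \<alpha>_eq)
    have decr: "F (x (Suc k)) \<le> F u - M * ((y k - x (Suc k)) \<bullet> (u - y k))
        - s / 2 * (norm (u - y k))\<^sup>2 - (M - \<xi>) / 2 * (norm (y k - x (Suc k)))\<^sup>2"
      if "u \<in> X" for u k
      unfolding assms(19)
    proof (rule proximal_step_decrease[where X = X and c = "c (y k)" and a = "H (B (y k))"])
      show "convex_on X R"
        using assms(2,8) by (auto intro: convex_on_subset)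
      show "is_arg_min (\<lambda>w. H (B (y k)) + c (y k) \<bullet> (w - y k) + M / 2 * (norm (w - y k))\<^sup>2 + R w)
          (\<lambda>w. w \<in> X) (x (Suc k))"
        using alg(4)[of k] by (simp add: cf_objective_def[abs_def] c_def M_def)
    qed (use assms(2) that lower upper xS yS in \<open>auto simp: span_base\<close>)
    have step: "V (Suc k) \<le> (1 - ?\<theta>) * V k" for k
      unfolding V_def
    proof (rule estimate_sequence_contraction[OF \<theta> less_imp_le[OF s] \<alpha>1 \<alpha>2 alg(3,5)])
      \<comment> \<open>At \<open>x k\<close> the quadratic gain with factor \<open>s\<close> is
        dropped; it is kept only at \<open>xstar\<close>, where it cancels the \<open>norm b\<close>
        term.\<close>
      have "0 \<le> s / 2 * (norm (x k - y k))\<^sup>2"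
        using s by simp
      with decr[OF xX, of k k]
      show "F (x (Suc k)) \<le> F (x k) - M * ((y k - x (Suc k)) \<bullet> (x k - y k))
          - (M - \<xi>) / 2 * (norm (y k - x (Suc k)))\<^sup>2"
        by linarith
    qed (rule decr[OF qX])
    have "V k \<le> (1 - ?\<theta>) ^ k * V 0"
    proof (induction k)
      case (Suc k)
      have "(1 - ?\<theta>) * V k \<le> (1 - ?\<theta>) * ((1 - ?\<theta>) ^ k * V 0)"
        using Suc \<theta> by (intro mult_left_mono) auto
      with step[of k] show ?case
        by (simp add: mult.assoc)
    qed simp
    with step show ?thesis
      by blast
  qed
  moreover have "F (x k) - F xstar \<le> V k" for k
    using s by (simp add: V_def)
  ultimately show ?thesis
    unfolding V_def s_def cf_theta_def by (meson order_trans)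
qed

end
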